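(* Let $(G,p,\ell)$ be a point-hyperplane framework in $\mathbb{R}^d$, let $\mathscr A$ be a smooth submanifold of $\mathbb{W}_G$ with $(p,\ell)\in\mathscr A$, and suppose that the points and hyperplanes of $(G,p,\ell)$ affinely span $\mathbb{R}^d$. If $(p,\ell)$ is an $\mathscr A$-regular point of $G$ and there exists an $\mathscr A$-preserving infinitesimal flex of $(G,p,\ell)$, then there also exists an $\mathscr A$-preserving finite flex of $(G,p,\ell)$.
   Context: A $\mathcal{PH}$-graph is a finite simple graph $G=(V_{\mathcal P}\cup V_{\mathcal H},E)$ with vertex set partitioned into non-empty sets $V_{\mathcal P}$ (size $n$) and $V_{\mathcal H}$ (size $k$); $E$ is partitioned into $E_{\mathcal{PP}},E_{\mathcal{PH}},E_{\mathcal{HH}}$ by types of end-vertices. A point-hyperplane framework $(G,p,\ell)$ in $\mathbb{R}^d$ has maps $p:V_{\mathcal P}\to\mathbb{R}^d$ and $\ell=(a,r):V_{\mathcal H}\to(\mathbb{R}^d\setminus\{0\})\times\mathbb{R}$; $j\in V_{\mathcal H}$ represents the hyperplane $\{x:\langle a_j,x\rangle=r_j\}$. The points and hyperplanes affinely span $\mathbb{R}^d$ if the points $p_i$ together with all points lying on the hyperplanes affinely span $\mathbb{R}^d$. The framework induces a decoration of $G$: $E_{\mathcal{HH}\parallel}$ is the set of edges $\{i,j\}\in E_{\mathcal{HH}}$ with $a_i$ parallel to $a_j$, $E_{\mathcal{HH}\not\parallel}=E_{\mathcal{HH}}\setminus E_{\mathcal{HH}\parallel}$, and the parallel classes of $V_{\mathcal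 H}$ are the connected components of $(V_{\mathcal H},E_{\mathcal{HH}\parallel})$. This partition is kept fixed when the configuration is varied. Put $\mathbb{W}_G=\{(q,m)\in\mathbb{R}^{dn}\oplus\mathbb{R}^{(d+1)k}: a_i\parallel a_j\ \text{for all } \{i,j\}\in E_{\mathcal{HH}\parallel}\}$, where $m_j=(a_j,r_j)$. The measurement map $f_G$ on $\mathbb{W}_G$ sends $(p_1,\ldots,p_n,\ell_1,\ldots,\ell_k)$, $\ell_j=(a_j,r_j)$, to the vector with components $\|p_i-p_j\|^2$ for $\{i,j\}\in E_{\mathcal{PP}}$, $\langle p_i,a_j\rangle-r_j$ for $\{i,j\}\in E_{\mathcal{PH}}$ ($i\in V_{\mathcal P}$, $j\in V_{\mathcal H}$), $\langle a_i,a_j\rangle$ for $\{i,j\}\in E_{\mathcal{HH}\not\parallel}$, and $\langle a_j,a_j\rangle$ for $j\in V_{\mathcal H}$. $K_{n+k}$ is the complete $\mathcal{PH}$-graph on the vertex set of $G$ with the same parallel classes; its hyperplane-hyperplane edges count as parallel iff both ends lie in the same class, and $f_{K_{n+k}}$ is defined on $\mathbb{W}_G$ by the same formulas for the edges of $K_{n+k}$. A smooth submanifold of $\mathbb{W}_G$ means a smooth submanifold of $\mathbb{R}^{dn+(d+1)k}$ contained in $\mathbb{W}_G$. $\tilde f_G,\tilde f_{K_{n+k}}$ are the restrictions of $f_G,f_{K_{n+k}}$ to $\mathscr A$, and $d\tilde f_G((q,m))$ is the Jacobian (differential) at $(q,m)\in\mathscr A$. $(p,\ell)$ is an $\mathscr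 A$-regular point of $G$ if there is a neighborhood $N$ of $(p,\ell)$ in $\mathscr A$ with $\mathrm{rank}\,d\tilde f_G((p,\ell))=\max\{\mathrm{rank}\,d\tilde f_G((q,m)):(q,m)\in N\}$. An $\mathscr A$-preserving infinitesimal motion is an element $(\dot p,\dot\ell)$ of the kernel of $d\tilde f_G((p,\ell))$ (a vector tangent to $\mathscr A$). It is trivial if there are a skew-symmetric $d\times d$ matrix $S$ and $b\in\mathbb{R}^d$ with $\dot p_i=Sp_i+b$ for all $i\in V_{\mathcal P}$ and $(\dot a_j,\dot r_j)=(Sa_j,\langle b,a_j\rangle)$ for all $j\in V_{\mathcal H}$. A non-trivial one is an $\mathscr A$-preserving infinitesimal flex. An $\mathscr A$-preserving (finite) flex of $(G,p,\ell)$ is a differentiable path $x:[0,1]\to\mathscr A$ such that $x(0)=(p,\ell)$ and $x(T)\in\tilde f_G^{-1}\big(\tilde f_G((p,\ell))\big)\setminus\tilde f_{K_{n+k}}^{-1}\big(\tilde f_{K_{n+k}}((p,\ell))\big)$ for all $T\in(0,1]$. *)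

theory Defs
  imports "HOL-Analysis.Analysis"
begin

section \<open>Smooth submanifolds of a Euclidean space\<close>

text \<open>\<open>C_on n S f\<close> says that \<open>f\<close> is of class \<open>C^n\<close> on the open set \<open>S\<close>: the derivative of order
  \<open>n\<close> is reached by taking Frechet derivatives in fixed directions \<open>v\<close> one after the other.\<close>

primrec C_on :: "nat \<Rightarrow> 'a set \<Rightarrow> ('a::real_normed_vector \<Rightarrow> 'b::real_normed_vector) \<Rightarrow> bool" where
  "C_on 0 S f \<longleftrightarrow> continuous_on S f"
| "C_on (Suc n) S f \<longleftrightarrow>
     (\<forall>x\<in>S. f differentiable (at x)) \<and>
     (\<forall>v. C_on n S (\<lambda>x. frechet_derivative f (at x) v))"

definition smooth_on :: "'a set \<Rightarrow> ('a::real_normed_vector \<Rightarrow> 'b::real_normed_vector) \<Rightarrow> bool" where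
  "smooth_on S f \<longleftrightarrow> (\<forall>n. C_on n S f)"

definition diffeomorphism_between ::
    "'a set \<Rightarrow> 'b set \<Rightarrow> ('a::real_normed_vector \<Rightarrow> 'b::real_normed_vector) \<Rightarrow> ('b \<Rightarrow> 'a) \<Rightarrow> bool" where
  "diffeomorphism_between U V \<phi> \<psi> \<longleftrightarrow>
     homeomorphism U V \<phi> \<psi> \<and> smooth_on U \<phi> \<and> smooth_on V \<psi>"

text \<open>Embedded submanifolds without boundary, of one fixed dimension \<open>m\<close>, via slice charts.\<close>

definition smooth_submanifold :: "'a::euclidean_space set \<Rightarrow> bool" where
  "smooth_submanifold A \<longleftrightarrow>
     (\<exists>m. \<forall>x\<in>A. \<exists>U (V :: 'a set) L \<phi> \<psi>.
        open U \<and> x \<in> U \<and> open V \<and> diffeomorphism_between U V \<phi> \<psi> \<and>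
        subspace L \<and> dim L = m \<and> \<phi> ` (A \<inter> U) = L \<inter> V)"

text \<open>Velocities at \<open>x\<close> of differentiable curves in \<open>A\<close> through \<open>x\<close>.\<close>

definition tangent_space :: "'a::euclidean_space set \<Rightarrow> 'a \<Rightarrow> 'a set" where
  "tangent_space A x =
     {v. \<exists>\<gamma> \<epsilon>. 0 < \<epsilon> \<and> \<gamma> differentiable_on {-\<epsilon><..<\<epsilon>} \<and> \<gamma> ` {-\<epsilon><..<\<epsilon>} \<subseteq> A \<and>
            \<gamma> 0 = x \<and> (\<gamma> has_vector_derivative v) (at (0::real))}"

text \<open>For \<open>f\<close> differentiable on the ambient space, the differential of its restriction to \<open>A\<close> at
  \<open>x \<in> A\<close> is the ambient derivative restricted to the tangent space of \<open>A\<close> at \<open>x\<close>.\<close>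

definition restricted_kernel ::
    "('a::euclidean_space \<Rightarrow> 'b::euclidean_space) \<Rightarrow> 'a set \<Rightarrow> 'a \<Rightarrow> 'a set" where
  "restricted_kernel f A x = {v \<in> tangent_space A x. frechet_derivative f (at x) v = 0}"

definition restricted_rank ::
    "('a::euclidean_space \<Rightarrow> 'b::euclidean_space) \<Rightarrow> 'a set \<Rightarrow> 'a \<Rightarrow> nat" where
  "restricted_rank f A x = dim (frechet_derivative f (at x) ` tangent_space A x)"


section \<open>Point-hyperplane frameworks\<close>

text \<open>A \<open>\<P>\<H>\<close>-graph has vertex set \<open>UNIV :: ('p + 'h) set\<close>, where the finite (and automatically
  nonempty) types \<open>'p\<close> and \<open>'h\<close> play the roles of the point vertices and the hyperplane vertices;
  it is given by its set of edges. The ambient dimension is \<open>CARD('d)\<close>.\<close>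

definition ph_graph :: "('p + 'h) set set \<Rightarrow> bool" where
  "ph_graph E \<longleftrightarrow> (\<forall>e\<in>E. card e = 2)"

type_synonym ('p, 'h, 'd) config = "((real, 'd) vec, 'p) vec \<times> ((real, 'd) vec \<times> real, 'h) vec"

definition pt :: "('p::finite, 'h::finite, 'd::finite) config \<Rightarrow> 'p \<Rightarrow> real^'d" where
  "pt x i = fst x $ i"

definition nrm :: "('p::finite, 'h::finite, 'd::finite) config \<Rightarrow> 'h \<Rightarrow> real^'d" where
  "nrm x j = fst (snd x $ j)"

definition off :: "('p::finite, 'h::finite, 'd::finite) config \<Rightarrow> 'h \<Rightarrow> real" where
  "off x j = snd (snd x $ j)"

definition framework :: "('p::finite + 'h::finite) set set \<Rightarrow> ('p, 'h, 'd::finite) config \<Rightarrow> bool" where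
  "framework E x \<longleftrightarrow> ph_graph E \<and> (\<forall>j. nrm x j \<noteq> 0)"

definition affinely_spanning :: "('p::finite, 'h::finite, 'd::finite) config \<Rightarrow> bool" where
  "affinely_spanning x \<longleftrightarrow>
     affine hull (range (pt x) \<union> (\<Union>j. {y. nrm x j \<bullet> y = off x j})) = UNIV"

text \<open>Linear dependence; the zero vector, which may occur in elements of \<open>\<W>\<^sub>G\<close> that are
  not frameworks, counts as parallel to every vector.\<close>

definition parallel :: "real^'d \<Rightarrow> real^'d \<Rightarrow> bool" where
  "parallel a b \<longleftrightarrow> collinear {0, a, b}"

text \<open>In all definitions below, \<open>x\<^sub>0\<close> is the framework \<open>(p,\<ell>)\<close> that induces the decoration of \<open>G\<close>; it
  stays fixed while the configuration varies.\<close>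

definition parallel_edges ::
    "('p::finite + 'h::finite) set set \<Rightarrow> ('p, 'h, 'd::finite) config \<Rightarrow> ('p + 'h) set set" where
  "parallel_edges E x\<^sub>0 =
     {e \<in> E. \<exists>i j. e = {Inr i, Inr j} \<and> parallel (nrm x\<^sub>0 i) (nrm x\<^sub>0 j)}"

definition same_class ::
    "('p::finite + 'h::finite) set set \<Rightarrow> ('p, 'h, 'd::finite) config \<Rightarrow> 'h \<Rightarrow> 'h \<Rightarrow> bool" where
  "same_class E x\<^sub>0 i j \<longleftrightarrow> (i, j) \<in> {(i, j). {Inr i, Inr j} \<in> parallel_edges E x\<^sub>0}\<^sup>*"

definition W ::
    "('p::finite + 'h::finite) set set \<Rightarrow> ('p, 'h, 'd::finite) config \<Rightarrow> ('p, 'h, 'd) config set" where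
  "W E x\<^sub>0 =
     {x. \<forall>i j. {Inr i, Inr j} \<in> parallel_edges E x\<^sub>0 \<longrightarrow> parallel (nrm x i) (nrm x j)}"

definition complete_edges :: "('p + 'h) set set" where
  "complete_edges = {e. card e = 2}"

definition complete_parallel_edges ::
    "('p::finite + 'h::finite) set set \<Rightarrow> ('p, 'h, 'd::finite) config \<Rightarrow> ('p + 'h) set set" where
  "complete_parallel_edges E x\<^sub>0 =
     {e \<in> complete_edges. \<exists>i j. e = {Inr i, Inr j} \<and> same_class E x\<^sub>0 i j}"


section \<open>The measurement map\<close>

fun pair_measurement ::
    "('p::finite, 'h::finite, 'd::finite) config \<Rightarrow> 'p + 'h \<Rightarrow> 'p + 'h \<Rightarrow> real" where
  "pair_measurement x (Inl i) (Inl j) = (norm (pt x i - pt x j))\<^sup>2"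
| "pair_measurement x (Inl i) (Inr j) = pt x i \<bullet> nrm x j - off x j"
| "pair_measurement x (Inr j) (Inl i) = pt x i \<bullet> nrm x j - off x j"
| "pair_measurement x (Inr i) (Inr j) = nrm x i \<bullet> nrm x j"

definition edge_measurement ::
    "('p::finite, 'h::finite, 'd::finite) config \<Rightarrow> ('p + 'h) set \<Rightarrow> real" where
  "edge_measurement x e = (THE c. \<exists>u v. e = {u, v} \<and> c = pair_measurement x u v)"

lemma pair_measurement_commute: "pair_measurement x u v = pair_measurement x v u"
  by (cases u; cases v) (simp_all add: norm_minus_commute inner_commute)

lemma edge_measurement_pair: "edge_measurement x {u, v} = pair_measurement x u v"
  unfolding edge_measurement_def
  by (rule the_equality) (auto simp: doubleton_eq_iff pair_measurement_commute)

text \<open>The measurement map of a graph with edge set \<open>E\<close>, of which the edges in \<open>P\<close> are the parallel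
  ones. Vertex sets that do not contribute a component are padded with the constant \<open>0\<close>, so that all
  graphs on the same vertices share one codomain; fibres and ranks are not affected.\<close>

definition measurement ::
    "('p + 'h) set set \<Rightarrow> ('p + 'h) set set \<Rightarrow> ('p::finite, 'h::finite, 'd::finite) config \<Rightarrow>
      real^(('p + 'h) set + 'h)" where
  "measurement E P x =
     (\<chi> c. case c of
        Inl e \<Rightarrow> if e \<in> E - P then edge_measurement x e else 0
      | Inr j \<Rightarrow> nrm x j \<bullet> nrm x j)"

definition f_G ::
    "('p::finite + 'h::finite) set set \<Rightarrow> ('p, 'h, 'd::finite) config \<Rightarrow> ('p, 'h, 'd) config \<Rightarrow>
      real^(('p + 'h) set + 'h)" where
  "f_G E x\<^sub>0 = measurement E (parallel_edges E x\<^sub>0)"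

definition f_K ::
    "('p::finite + 'h::finite) set set \<Rightarrow> ('p, 'h, 'd::finite) config \<Rightarrow> ('p, 'h, 'd) config \<Rightarrow>
      real^(('p + 'h) set + 'h)" where
  "f_K E x\<^sub>0 = measurement complete_edges (complete_parallel_edges E x\<^sub>0)"


section \<open>Regularity and flexes relative to a submanifold\<close>

definition regular_point ::
    "('p::finite + 'h::finite) set set \<Rightarrow> ('p, 'h, 'd::finite) config \<Rightarrow> ('p, 'h, 'd) config set \<Rightarrow>
      bool" where
  "regular_point E x\<^sub>0 A \<longleftrightarrow>
     (\<exists>N. openin (top_of_set A) N \<and> x\<^sub>0 \<in> N \<and>
        restricted_rank (f_G E x\<^sub>0) A x\<^sub>0 = Max (restricted_rank (f_G E x\<^sub>0) A ` N))"

definition infinitesimal_motion ::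
    "('p::finite + 'h::finite) set set \<Rightarrow> ('p, 'h, 'd::finite) config \<Rightarrow> ('p, 'h, 'd) config set \<Rightarrow>
      ('p, 'h, 'd) config \<Rightarrow> bool" where
  "infinitesimal_motion E x\<^sub>0 A v \<longleftrightarrow> v \<in> restricted_kernel (f_G E x\<^sub>0) A x\<^sub>0"

definition trivial_motion ::
    "('p::finite, 'h::finite, 'd::finite) config \<Rightarrow> ('p, 'h, 'd) config \<Rightarrow> bool" where
  "trivial_motion x\<^sub>0 v \<longleftrightarrow>
     (\<exists>(S :: real^'d^'d) b. transpose S = - S \<and>
        (\<forall>i. pt v i = S *v pt x\<^sub>0 i + b) \<and>
        (\<forall>j. nrm v j = S *v nrm x\<^sub>0 j \<and> off v j = b \<bullet> nrm x\<^sub>0 j))"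

definition infinitesimal_flex ::
    "('p::finite + 'h::finite) set set \<Rightarrow> ('p, 'h, 'd::finite) config \<Rightarrow> ('p, 'h, 'd) config set \<Rightarrow>
      ('p, 'h, 'd) config \<Rightarrow> bool" where
  "infinitesimal_flex E x\<^sub>0 A v \<longleftrightarrow> infinitesimal_motion E x\<^sub>0 A v \<and> \<not> trivial_motion x\<^sub>0 v"

definition finite_flex ::
    "('p::finite + 'h::finite) set set \<Rightarrow> ('p, 'h, 'd::finite) config \<Rightarrow> ('p, 'h, 'd) config set \<Rightarrow>
      (real \<Rightarrow> ('p, 'h, 'd) config) \<Rightarrow> bool" where
  "finite_flex E x\<^sub>0 A \<gamma> \<longleftrightarrow>
     \<gamma> differentiable_on {0..1} \<and> \<gamma> ` {0..1} \<subseteq> A \<and> \<gamma> 0 = x\<^sub>0 \<and>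
     (\<forall>T\<in>{0<..1}. f_G E x\<^sub>0 (\<gamma> T) = f_G E x\<^sub>0 x\<^sub>0 \<and> f_K E x\<^sub>0 (\<gamma> T) \<noteq> f_K E x\<^sub>0 x\<^sub>0)"

end

theory Submission
  imports Defs
begin

text \<open>By regularity, the restriction of \<open>f_G\<close> to \<open>A\<close> has locally maximal rank at \<open>x\<^sub>0\<close>, so in a chart the
  inverse function theorem yields a curve \<open>\<gamma>\<close> in the fibre of \<open>x\<^sub>0\<close> with any prescribed velocity \<open>v\<close> in
  the kernel of the differential. If \<open>\<gamma> t\<close> had the same complete measurements as \<open>x\<^sub>0\<close> for arbitrarily
  small \<open>t > 0\<close>, then the Gram matrix of the differences of points and of the normals would return to
  its initial value at these times, and passing to the limit in the difference quotients would show
  that \<open>v\<close> is induced by a skew-symmetric map and a translation. Hence for a nontrivial \<open>v\<close> the initial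
  piece of \<open>\<gamma>\<close> is a finite flex. Complete frameworks with degenerate point sets can have nontrivial
  infinitesimal motions, so it would not suffice to compare the kernels of the differentials of
  \<open>f_G\<close> and \<open>f_K\<close>.\<close>

section \<open>Maps of class \<open>C^1\<close>\<close>

text \<open>Derivatives are unique, so any explicit derivative agrees with the
  \<open>frechet_derivative\<close> chosen in \<open>C_on\<close>. The algebraic rules below can
  thus exhibit a formula and check its continuity one direction at a time.\<close>

lemma C_on_1I:
  assumes "\<And>x. x \<in> S \<Longrightarrow> (f has_derivative f' x) (at x)"
    and "\<And>v. continuous_on S (\<lambda>x. f' x v)"
  shows "C_on (Suc 0) S f"
proof -
  have *: "frechet_derivative f (at x) = f' x" if "x \<in> S" for x
    using frechet_derivative_at[OF assms(1)[OF that]] by simp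
  have "continuous_on S (\<lambda>x. frechet_derivative f (at x) v)" for v
    using assms(2)[of v] by (rule continuous_on_eq) (simp add: *)
  then show ?thesis
    using assms(1) by (auto simp: differentiable_def)
qed

lemma C_on_1D:
  assumes "C_on (Suc 0) S f"
  shows "x \<in> S \<Longrightarrow> (f has_derivative frechet_derivative f (at x)) (at x)"
    and "continuous_on S (\<lambda>x. frechet_derivative f (at x) v)"
    and "continuous_on S f"
  using assms by (auto simp: frechet_derivative_works[symmetric]
      intro!: continuous_at_imp_continuous_on differentiable_imp_continuous_within)

lemma C_on_1_bounded_linear:
  assumes "bounded_linear f"
  shows "C_on (Suc 0) S f"
  by (rule C_on_1I[where f' = "\<lambda>_. f"]) (auto intro: bounded_linear_imp_has_derivative assms)

lemma C_on_1_const: "C_on (Suc 0) S (\<lambda>_. c)"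
  by (rule C_on_1I[where f' = "\<lambda>_ _. 0"]) auto

lemma C_on_1_diff:
  assumes "C_on (Suc 0) S f" "C_on (Suc 0) S g"
  shows "C_on (Suc 0) S (\<lambda>x. f x - g x)"
  by (rule C_on_1I[where f' = "\<lambda>x v. frechet_derivative f (at x) v - frechet_derivative g (at x) v"])
    (auto intro!: has_derivative_diff continuous_on_diff C_on_1D[OF assms(1)] C_on_1D[OF assms(2)])

lemma C_on_1_inner:
  fixes f g :: "'a::real_normed_vector \<Rightarrow> 'b::real_inner"
  assumes "C_on (Suc 0) S f" "C_on (Suc 0) S g"
  shows "C_on (Suc 0) S (\<lambda>x. f x \<bullet> g x)"
  by (rule C_on_1I[where f' = "\<lambda>x v. f x \<bullet> frechet_derivative g (at x) v
        + frechet_derivative f (at x) v \<bullet> g x"])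
    (auto intro!: has_derivative_inner continuous_on_add continuous_on_inner
      C_on_1D[OF assms(1)] C_on_1D[OF assms(2)])

lemma C_on_1_vec:
  fixes f :: "'a::real_normed_vector \<Rightarrow> real^'n"
  assumes "\<And>i. C_on (Suc 0) S (\<lambda>x. f x $ i)"
  shows "C_on (Suc 0) S f"
proof (rule C_on_1I)
  show "(f has_derivative (\<lambda>v. \<chi> i. frechet_derivative (\<lambda>x. f x $ i) (at x) v)) (at x)"
    if "x \<in> S" for x
    using C_on_1D(1)[OF assms that]
    by (subst has_derivative_componentwise_within)
      (auto simp: Basis_vec_def inner_axis intro!: derivative_intros)
  show "continuous_on S (\<lambda>x. \<chi> i. frechet_derivative (\<lambda>x. f x $ i) (at x) v)" for v
    by (intro continuous_on_vec_lambda C_on_1D(2)[OF assms])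
qed

text \<open>Expanding \<open>h u\<close> in the finite basis gives a finite sum of products of
  continuous functions. This upgrades the continuity in fixed directions that \<open>C_on\<close>
  provides to varying directions.\<close>

lemma continuous_on_linear_apply:
  fixes D :: "'u::topological_space \<Rightarrow> 'a::euclidean_space \<Rightarrow> 'b::real_normed_vector"
  assumes lin: "\<And>u. u \<in> S \<Longrightarrow> linear (D u)"
    and D: "\<And>v. continuous_on S (\<lambda>u. D u v)" and h: "continuous_on S h"
  shows "continuous_on S (\<lambda>u. D u (h u))"
proof -
  have "D u (h u) = (\<Sum>b\<in>Basis. (h u \<bullet> b) *\<^sub>R D u b)" if "u \<in> S" for u
  proof -
    interpret linear "D u" by (rule lin[OF that])
    show ?thesis
      by (subst euclidean_representation[of "h u", symmetric]) (simp add: sum scale del: euclidean_representation)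
  qed
  moreover have "continuous_on S (\<lambda>u. \<Sum>b\<in>Basis. (h u \<bullet> b) *\<^sub>R D u b)"
    by (intro continuous_intros D h)
  ultimately show ?thesis
    by (simp cong: continuous_on_cong)
qed

section \<open>Curves in the fibres of a map of locally maximal rank\<close>

text \<open>A linear right inverse \<open>h\<close> of \<open>g\<close> embeds the image of
  \<open>R\<close> into \<open>R\<close>, and by comparison of dimensions it reaches all of
  \<open>R\<close>. So \<open>y = h z\<close> with \<open>z = g y = 0\<close>.\<close>

lemma linear_zero_if_dim_le_dim_image:
  fixes g :: "'a::euclidean_space \<Rightarrow> 'b::euclidean_space"
  assumes "linear g" "subspace R" "dim R \<le> dim (g ` R)" "y \<in> R" "g y = 0"
  shows "y = 0"
proof -
  obtain h where h: "range h \<subseteq> R" "linear h" "\<And>z. z \<in> g ` R \<Longrightarrow> g (h z) = z"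
    using linear_exists_right_inverse_on[OF assms(1,2)] by auto
  have sub: "subspace (g ` R)"
    using assms(1,2) by (simp add: linear_subspace_image)
  have "inj_on h (g ` R)"
    by (rule inj_on_inverseI[where g = g]) (use h(3) in auto)
  then have "dim (h ` g ` R) = dim (g ` R)"
    using dim_image_eq[OF h(2), of "g ` R"] span_eq_iff[of "g ` R"] sub by metis
  moreover have "subspace (h ` g ` R)"
    using h(2) sub by (simp add: linear_subspace_image)
  ultimately have "h ` g ` R = R"
    using subspace_dim_equal[of "h ` g ` R" R] assms(2,3) h(1) by auto
  then obtain z where "z \<in> g ` R" "y = h z"
    using assms(4) by auto
  then show ?thesis
    using h(3)[of z] assms(5) linear_0[OF h(2)] by simp
qed

text \<open>Because the rank is locally maximal at \<open>u\<^sub>0\<close>, a local change of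
  coordinates turns a straight line in direction \<open>w\<close> into a curve whose velocity is
  annihilated by \<open>F'\<close> at every time, not only at time 0. Hence \<open>F\<close> is
  constant along it.\<close>

lemma constant_rank_curve:
  fixes F :: "'a::euclidean_space \<Rightarrow> 'b::euclidean_space"
  assumes U: "open U" "u\<^sub>0 \<in> U"
    and F: "\<And>u. u \<in> U \<Longrightarrow> (F has_derivative F' u) (at u)"
    and cont: "\<And>v. continuous_on U (\<lambda>u. F' u v)"
    and rank: "\<And>u. u \<in> U \<Longrightarrow> dim (range (F' u)) \<le> dim (range (F' u\<^sub>0))"
    and w: "F' u\<^sub>0 w = 0"
  obtains c c' \<epsilon> where "0 < \<epsilon>" "c 0 = u\<^sub>0" "c' 0 = w"
    "\<And>t. t \<in> {-\<epsilon><..<\<epsilon>} \<Longrightarrow> c t \<in> U \<and> F (c t) = F u\<^sub>0 \<and> (c has_vector_derivative c' t) (at t)"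
proof -
  define T where "T = F' u\<^sub>0"
  have linF: "linear (F' u)" if "u \<in> U" for u
    using F[OF that] by (simp add: has_derivative_linear)
  have linT: "linear T"
    unfolding T_def by (rule linF[OF U(2)])
  \<comment> \<open>\<open>G\<close> is a generalized inverse of the differential at
    \<open>u\<^sub>0\<close>: \<open>T \<circ> G\<close> fixes the range of
    \<open>T\<close>.\<close>
  obtain G where linG: "linear G" and G: "\<And>x. T (G (T x)) = T x"
    using linear_exists_right_inverse_on[OF linT subspace_UNIV] by auto
  \<comment> \<open>Straightens \<open>F\<close> up to the projection \<open>T \<circ> G\<close> onto the range of \<open>T\<close>: \<open>T (\<Phi> u) = T (G (F u))\<close>.\<close>
  define \<Phi> where "\<Phi> u = u - G (T u) + G (F u)" for u
  define \<Phi>' where "\<Phi>' u v = v - G (T v) + G (F' u v)" for u v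
  note blG = linear_conv_bounded_linear[THEN iffD1, OF linG]
  note blT = linear_conv_bounded_linear[THEN iffD1, OF linT]
  have der: "(\<Phi> has_derivative \<Phi>' u) (at u)" if "u \<in> U" for u
    unfolding \<Phi>_def[abs_def] \<Phi>'_def[abs_def]
    by (intro has_derivative_add has_derivative_diff has_derivative_ident
        bounded_linear.has_derivative[OF blG] F[OF that]
        bounded_linear.has_derivative[OF blT])
  have bl: "bounded_linear (\<Phi>' u)" if "u \<in> U" for u
    using der[OF that] by (rule has_derivative_bounded_linear)
  have contB: "continuous_on U (\<lambda>u. Blinfun (\<Phi>' u))"
  proof (rule continuous_on_blinfun_componentwise)
    fix b :: 'a
    have "continuous_on U (\<lambda>u. \<Phi>' u b)"
      unfolding \<Phi>'_def[abs_def]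
      by (intro continuous_intros bounded_linear.continuous_on[OF blG] cont)
    then show "continuous_on U (\<lambda>u. blinfun_apply (Blinfun (\<Phi>' u)) b)"
      by (rule continuous_on_eq) (simp add: bounded_linear_Blinfun_apply bl)
  qed
  \<comment> \<open>At \<open>u\<^sub>0\<close> the two correction terms cancel, so the inverse
    function theorem applies to \<Phi> there.\<close>
  have \<Phi>'0: "\<Phi>' u\<^sub>0 = (\<lambda>v. v)"
    by (simp add: \<Phi>'_def T_def fun_eq_iff)
  have inv0: "id_blinfun o\<^sub>L Blinfun (\<Phi>' u\<^sub>0) = id_blinfun"
    by (rule blinfun_eqI) (simp add: bounded_linear_Blinfun_apply bl U \<Phi>'0)
  obtain U' V g g' where U': "open U'" "U' \<subseteq> U" "u\<^sub>0 \<in> U'" and V: "open V" "\<Phi> u\<^sub>0 \<in> V"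
    and hom: "homeomorphism U' V \<Phi> g"
    and g: "\<And>y. y \<in> V \<Longrightarrow> (g has_derivative (g' y)) (at y)"
    and g': "\<And>y. y \<in> V \<Longrightarrow> g' y = inv (blinfun_apply (Blinfun (\<Phi>' (g y))))"
    and bij: "\<And>y. y \<in> V \<Longrightarrow> bij (blinfun_apply (Blinfun (\<Phi>' (g y))))"
    using inverse_function_theorem[OF U(1) _ contB U(2) inv0] der bl
    by (metis (no_types, lifting) bounded_linear_Blinfun_apply)
  have gU: "g y \<in> U'" "\<Phi> (g y) = y" if "y \<in> V" for y
    using hom that by (auto simp: homeomorphism_def)
  have gU2: "g y \<in> U" if "y \<in> V" for y
    using gU(1)[OF that] U'(2) by auto
  have bij': "bij (\<Phi>' (g y))" and g'2: "g' y = inv (\<Phi>' (g y))" if "y \<in> V" for y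
    using bij[OF that] g'[OF that] bl[OF gU2[OF that]] by (simp_all add: bounded_linear_Blinfun_apply)
  \<comment> \<open>As \<open>T w = 0\<close>, the value of \<open>T\<close> is constant along this
    line. The local inverse \<open>g\<close> pulls it back to the desired curve.\<close>
  define l where "l t = \<Phi> u\<^sub>0 + t *\<^sub>R w" for t
  have "open (l -` V)"
    unfolding l_def[abs_def] by (intro open_vimage V continuous_intros)
  moreover have "0 \<in> l -` V"
    using V by (simp add: l_def)
  ultimately obtain \<epsilon> where \<epsilon>: "0 < \<epsilon>" "ball 0 \<epsilon> \<subseteq> l -` V"
    using open_contains_ball by blast
  have lV: "l t \<in> V" if "t \<in> {-\<epsilon><..<\<epsilon>}" for t
    using \<epsilon>(2) that by (auto simp: subset_iff dist_real_def)
  define c where "c t = g (l t)" for t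
  define c' where "c' t = g' (l t) w" for t
  have gu0: "g (\<Phi> u\<^sub>0) = u\<^sub>0"
    using hom U'(3) by (simp add: homeomorphism_def)
  have c0: "c 0 = u\<^sub>0"
    by (simp add: c_def l_def gu0)
  have c'0: "c' 0 = w"
  proof -
    have "g' (\<Phi> u\<^sub>0) = inv (\<lambda>v. v)"
      using g'2[OF V(2)] by (simp add: gu0 \<Phi>'0)
    then show ?thesis
      using inv_id unfolding id_def by (simp add: c'_def l_def)
  qed
  have der_c: "(c has_vector_derivative c' t) (at t)" if t: "t \<in> {-\<epsilon><..<\<epsilon>}" for t
  proof -
    have "(l has_derivative (\<lambda>s. s *\<^sub>R w)) (at t)"
      unfolding l_def[abs_def] by (auto intro!: derivative_eq_intros)
    from has_derivative_compose[OF this g[OF lV[OF t]]]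
    have "((\<lambda>t. g (l t)) has_derivative (\<lambda>s. g' (l t) (s *\<^sub>R w))) (at t)" .
    moreover have "linear (g' (l t))"
      using g[OF lV[OF t]] by (simp add: has_derivative_linear)
    ultimately show ?thesis
      unfolding has_vector_derivative_def c_def[abs_def] c'_def by (simp add: linear_cmul)
  qed
  have T\<Phi>': "T (\<Phi>' u v) = T (G (F' u v))" for u v
    using linT G by (simp add: \<Phi>'_def linear_add linear_diff)
  have zero: "F' (c t) (c' t) = 0" if t: "t \<in> {-\<epsilon><..<\<epsilon>}" for t
  proof -
    have u: "c t \<in> U" and surj: "surj (\<Phi>' (c t))"
      using gU2[OF lV[OF t]] bij'[OF lV[OF t]] by (simp_all add: c_def bij_def)
    have "\<Phi>' (c t) (c' t) = w"
      using surj by (simp add: c'_def g'2[OF lV[OF t]] c_def[symmetric] surj_f_inv_f)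
    then have 0: "(T \<circ> G) (F' (c t) (c' t)) = 0"
      using T\<Phi>'[of "c t" "c' t"] w by (simp add: T_def)
    \<comment> \<open>Since \<open>\<Phi>' (c t)\<close> is onto, \<open>T \<circ> G\<close> maps
      the range of \<open>F' (c t)\<close> onto the range of \<open>T\<close>. By the rank
      hypothesis no dimension is lost, so \<open>T \<circ> G\<close> is injective there and the
      vector that it annihilates is zero.\<close>
    have "(T \<circ> G) ` range (F' (c t)) = T ` range (\<Phi>' (c t))"
      by (simp add: image_image T\<Phi>')
    then have "(T \<circ> G) ` range (F' (c t)) = range T"
      using surj by simp
    then have "dim (range (F' (c t))) \<le> dim ((T \<circ> G) ` range (F' (c t)))"
      using rank[OF u] by (simp add: T_def)
    moreover have "linear (T \<circ> G)"
      by (rule linear_compose[OF linG linT])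
    moreover have "subspace (range (F' (c t)))"
      using linF[OF u] by (simp add: linear_subspace_image)
    ultimately show ?thesis
      using linear_zero_if_dim_le_dim_image[of "T \<circ> G" "range (F' (c t))" "F' (c t) (c' t)"] 0 by blast
  qed
  have const: "F (c t) = F u\<^sub>0" if t: "t \<in> {-\<epsilon><..<\<epsilon>}" for t
  proof -
    have "((\<lambda>t. F (c t)) has_derivative (\<lambda>h. 0)) (at s within {-\<epsilon><..<\<epsilon>})" if s: "s \<in> {-\<epsilon><..<\<epsilon>}" for s
    proof -
      have u: "c s \<in> U" using gU2[OF lV[OF s]] by (simp add: c_def)
      have "((\<lambda>t. F (c t)) has_derivative (\<lambda>h. F' (c s) (h *\<^sub>R c' s))) (at s)"
        using has_derivative_compose[OF der_c[OF s, unfolded has_vector_derivative_def] F[OF u]] .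
      then show ?thesis
        using zero[OF s] linF[OF u] by (simp add: linear_cmul has_derivative_at_withinI)
    qed
    from has_derivative_zero_unique[OF _ this t, of 0] \<epsilon>(1) c0 show ?thesis by simp
  qed
  show ?thesis
    by (rule that[of \<epsilon> c c']) (use \<epsilon>(1) c0 c'0 const der_c gU2 lV in \<open>auto simp: c_def\<close>)
qed

lemma has_vector_derivative_quotient:
  assumes "(f has_vector_derivative f') (at 0)"
  shows "((\<lambda>t. (f t - f 0) /\<^sub>R t) \<longlongrightarrow> f') (at 0)"
proof -
  have "((\<lambda>t. norm ((f t - f 0) /\<^sub>R t - f')) \<longlongrightarrow> 0) (at 0)"
  proof (rule Lim_transform_eventually)
    show "((\<lambda>t. norm (f t - f 0 - t *\<^sub>R f') / norm t) \<longlongrightarrow> 0) (at 0)"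
      using assms by (simp only: has_vector_derivative_def has_derivative_iff_norm) simp
    have "norm (f t - f 0 - t *\<^sub>R f') / norm t = norm ((f t - f 0) /\<^sub>R t - f')" if "t \<noteq> 0" for t
    proof -
      have "(f t - f 0) /\<^sub>R t - f' = (f t - f 0 - t *\<^sub>R f') /\<^sub>R t"
        using that by (simp add: scaleR_diff_right)
      then show ?thesis by (simp add: divide_inverse mult.commute)
    qed
    then show "\<forall>\<^sub>F t in at 0. norm (f t - f 0 - t *\<^sub>R f') / norm t = norm ((f t - f 0) /\<^sub>R t - f')"
      by (auto simp: eventually_at_filter)
  qed
  then show ?thesis
    by (simp add: tendsto_norm_zero_iff Lim_null[symmetric])
qed

section \<open>Charts of a submanifold\<close>

lemma smooth_on_C_on_1: "smooth_on S f \<Longrightarrow> C_on (Suc 0) S f"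
  unfolding smooth_on_def by blast

text \<open>Near \<open>x\<close> the chart carries curves in \<open>A\<close> to curves in
  \<open>L\<close>, whose velocities stay in \<open>L\<close> because subspaces are closed.
  Conversely, \<open>\<psi>\<close> carries short line segments in \<open>L\<close> to curves in
  \<open>A\<close>. The set of velocities is thereby a linear image of \<open>L\<close>.\<close>

lemma tangent_space_chart:
  fixes A U V :: "'a::euclidean_space set"
  assumes U: "open U" "open V" and diff: "diffeomorphism_between U V \<phi> \<psi>"
    and L: "subspace L" "\<phi> ` (A \<inter> U) = L \<inter> V" and x: "x \<in> A" "x \<in> U"
  shows "tangent_space A x = frechet_derivative \<psi> (at (\<phi> x)) ` L"
proof -
  have hom: "homeomorphism U V \<phi> \<psi>" and sm: "C_on (Suc 0) U \<phi>" "C_on (Suc 0) V \<psi>"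
    using diff by (auto simp: diffeomorphism_between_def smooth_on_C_on_1 simp del: C_on.simps)
  define y where "y = \<phi> x"
  have y: "y \<in> V" "y \<in> L" "\<psi> y = x"
    using hom x L(2) by (auto simp: y_def homeomorphism_def)
  have D\<phi>: "(\<phi> has_derivative frechet_derivative \<phi> (at x)) (at x)"
    by (rule C_on_1D(1)[OF sm(1) x(2)])
  have D\<psi>: "(\<psi> has_derivative frechet_derivative \<psi> (at y)) (at y)"
    by (rule C_on_1D(1)[OF sm(2) y(1)])
  \<comment> \<open>Near \<open>x\<close> the map \<open>\<psi> \<circ> \<phi>\<close> is the
    identity; computing its derivative in two ways shows that the derivative of \<psi> undoes that
    of \<phi>.\<close>
  have "((\<lambda>z. \<psi> (\<phi> z)) has_derivative (\<lambda>v. frechet_derivative \<psi> (at y) (frechet_derivative \<phi> (at x) v))) (at x)"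
    using has_derivative_compose[OF D\<phi> D\<psi>[unfolded y_def]] by (simp add: y_def)
  moreover have "((\<lambda>z. \<psi> (\<phi> z)) has_derivative (\<lambda>v. v)) (at x)"
    by (rule has_derivative_transform_within_open[OF has_derivative_ident U(1) x(2)])
      (use hom in \<open>auto simp: homeomorphism_def\<close>)
  ultimately have inv: "frechet_derivative \<psi> (at y) (frechet_derivative \<phi> (at x) v) = v" for v
    using has_derivative_unique by metis
  show ?thesis
    unfolding y_def[symmetric]
  proof (intro equalityI subsetI)
    fix v assume "v \<in> tangent_space A x"
    then obtain \<gamma> \<epsilon> where \<gamma>: "0 < \<epsilon>" "\<gamma> ` {-\<epsilon><..<\<epsilon>} \<subseteq> A" "\<gamma> 0 = x"
      "(\<gamma> has_vector_derivative v) (at (0::real))"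
      by (auto simp: tangent_space_def)
    have D: "((\<lambda>t. \<phi> (\<gamma> t)) has_vector_derivative frechet_derivative \<phi> (at x) v) (at 0)"
      using vector_derivative_diff_chain_within[of \<gamma> v 0 UNIV \<phi> "frechet_derivative \<phi> (at x)"]
        \<gamma>(3,4) D\<phi> by (simp add: o_def has_derivative_at_withinI)
    have ev: "\<forall>\<^sub>F t in at 0. \<phi> (\<gamma> t) \<in> L"
    proof -
      have "isCont \<gamma> 0"
        using \<gamma>(4) by (rule has_vector_derivative_continuous)
      then have "\<forall>\<^sub>F t in at 0. \<gamma> t \<in> U"
        using U(1) x(2) \<gamma>(3) by (auto simp: isCont_def dest!: topological_tendstoD)
      moreover have "\<forall>\<^sub>F t in at 0. t \<in> {-\<epsilon><..<\<epsilon>}"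
        by (rule eventually_at_in_open'[OF open_greaterThanLessThan]) (use \<gamma>(1) in auto)
      ultimately show ?thesis
        by eventually_elim (use \<gamma>(2) L(2) in blast)
    qed
    have "((\<lambda>t. (\<phi> (\<gamma> t) - y) /\<^sub>R t) \<longlongrightarrow> frechet_derivative \<phi> (at x) v) (at 0)"
      using has_vector_derivative_quotient[OF D] \<gamma>(3) by (simp add: y_def)
    moreover have "\<forall>\<^sub>F t in at 0. (\<phi> (\<gamma> t) - y) /\<^sub>R t \<in> L"
      using ev by eventually_elim (intro subspace_scale subspace_diff L y)
    ultimately have "frechet_derivative \<phi> (at x) v \<in> L"
      using Lim_in_closed_set[OF closed_subspace[OF L(1)]] by (metis trivial_limit_at)
    then show "v \<in> frechet_derivative \<psi> (at y) ` L"
      using inv[of v] by force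
  next
    fix v assume "v \<in> frechet_derivative \<psi> (at y) ` L"
    then obtain w where w: "w \<in> L" "v = frechet_derivative \<psi> (at y) w" by auto
    define l where "l t = y + t *\<^sub>R w" for t
    have "open (l -` V)"
      unfolding l_def[abs_def] by (intro open_vimage U continuous_intros)
    moreover have "0 \<in> l -` V"
      using y by (simp add: l_def)
    ultimately obtain \<epsilon> where \<epsilon>: "0 < \<epsilon>" "ball 0 \<epsilon> \<subseteq> l -` V"
      using open_contains_ball by blast
    have lV: "l t \<in> V" if "t \<in> {-\<epsilon><..<\<epsilon>}" for t
      using \<epsilon>(2) that by (auto simp: subset_iff dist_real_def)
    have lL: "l t \<in> L" for t
      unfolding l_def by (intro subspace_add subspace_scale L y w)
    have Dl: "(l has_vector_derivative w) (at t)" for t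
      unfolding l_def[abs_def] by (auto intro!: derivative_eq_intros)
    have D: "((\<lambda>t. \<psi> (l t)) has_vector_derivative frechet_derivative \<psi> (at (l t)) w) (at t)"
      if "t \<in> {-\<epsilon><..<\<epsilon>}" for t
      using vector_derivative_diff_chain_within[of l w t UNIV \<psi> "frechet_derivative \<psi> (at (l t))"]
        Dl C_on_1D(1)[OF sm(2) lV[OF that]] by (simp add: o_def has_derivative_at_withinI)
    have "(\<lambda>t. \<psi> (l t)) differentiable_on {-\<epsilon><..<\<epsilon>}"
      unfolding differentiable_on_def
      using D by (metis differentiableI_vector differentiable_at_withinI)
    moreover have "\<psi> (l t) \<in> A" if "t \<in> {-\<epsilon><..<\<epsilon>}" for t
    proof -
      have "l t \<in> \<phi> ` (A \<inter> U)" using lV[OF that] lL L(2) by auto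
      then show ?thesis using hom by (auto simp: homeomorphism_def)
    qed
    moreover have "((\<lambda>t. \<psi> (l t)) has_vector_derivative v) (at 0)"
      using D[of 0] \<epsilon>(1) w(2) by (simp add: l_def)
    moreover have "\<psi> (l 0) = x" using y by (simp add: l_def)
    ultimately show "v \<in> tangent_space A x"
      unfolding tangent_space_def using \<epsilon>(1) by blast
  qed
qed

text \<open>A chart moves the problem to the subspace \<open>L\<close>. Precomposing with a
  projection \<open>P\<close> onto \<open>L\<close> then gives a map on an open set of the ambient
  space with the same ranges of derivatives, so that \<open>constant_rank_curve\<close>
  applies.\<close>

lemma submanifold_fibre_curve:
  fixes f :: "'a::euclidean_space \<Rightarrow> 'b::euclidean_space"
  assumes A: "smooth_submanifold A" "x\<^sub>0 \<in> A"
    and f: "C_on (Suc 0) UNIV f"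
    and N: "openin (top_of_set A) N" "x\<^sub>0 \<in> N"
    and rank: "\<And>y. y \<in> N \<Longrightarrow> restricted_rank f A y \<le> restricted_rank f A x\<^sub>0"
    and v: "v \<in> restricted_kernel f A x\<^sub>0"
  obtains \<gamma> \<epsilon> where "0 < \<epsilon>" "\<gamma> 0 = x\<^sub>0" "(\<gamma> has_vector_derivative v) (at 0)"
    "\<And>t. t \<in> {-\<epsilon><..<\<epsilon>} \<Longrightarrow> \<gamma> t \<in> A \<and> f (\<gamma> t) = f x\<^sub>0 \<and> \<gamma> differentiable (at t)"
proof -
  obtain U and V :: "'a set" and L \<phi> \<psi> where U: "open U" "x\<^sub>0 \<in> U" "open V" and diff: "diffeomorphism_between U V \<phi> \<psi>"
    and L: "subspace L" "\<phi> ` (A \<inter> U) = L \<inter> V"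
    using A unfolding smooth_submanifold_def by blast
  have hom: "homeomorphism U V \<phi> \<psi>" and sm: "C_on (Suc 0) V \<psi>"
    using diff by (auto simp: diffeomorphism_between_def smooth_on_C_on_1 simp del: C_on.simps)
  obtain N' where N': "open N'" "N = A \<inter> N'"
    using N(1) by (auto simp: openin_open)
  obtain P where P: "range P \<subseteq> L" "linear P" "\<And>z. z \<in> L \<Longrightarrow> P z = z"
    using linear_exists_left_inverse_on[OF linear_id L(1)] by auto
  have rangeP: "range P = L"
    using P(1,3) by (metis rangeI subsetI subset_antisym)
  note blP = linear_conv_bounded_linear[THEN iffD1, OF P(2)]
  \<comment> \<open>Projected points of \<open>D\<close> lie in the chart, and their images under
    \<open>\<psi>\<close> lie in \<open>N\<close>, where the rank bound holds.\<close>
  define D where "D = P -` (V \<inter> \<psi> -` N')"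
  have "open (V \<inter> \<psi> -` N')"
    by (rule continuous_open_preimage[OF C_on_1D(3)[OF sm] U(3) N'(1)])
  then have openD: "open D"
    unfolding D_def by (intro open_vimage linear_continuous_on[OF blP])
  define u\<^sub>0 where "u\<^sub>0 = \<phi> x\<^sub>0"
  have u0: "u\<^sub>0 \<in> L" "u\<^sub>0 \<in> V" "\<psi> u\<^sub>0 = x\<^sub>0"
    using hom U(2) A(2) L(2) by (auto simp: u\<^sub>0_def homeomorphism_def)
  have u0D: "u\<^sub>0 \<in> D"
    using u0 N(2) N'(2) by (simp add: D_def P(3))
  have DA: "\<psi> (P u) \<in> A" "\<psi> (P u) \<in> U" "\<psi> (P u) \<in> N" "P u \<in> V" "\<phi> (\<psi> (P u)) = P u" if "u \<in> D" for u
  proof -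
    have Pu: "P u \<in> V" "\<psi> (P u) \<in> N'" using that by (auto simp: D_def)
    moreover have "P u \<in> \<phi> ` (A \<inter> U)" using Pu(1) P(1) L(2) by blast
    ultimately show "\<psi> (P u) \<in> A" "\<psi> (P u) \<in> U" "\<psi> (P u) \<in> N" "P u \<in> V" "\<phi> (\<psi> (P u)) = P u"
      using hom N'(2) by (auto simp: homeomorphism_def)
  qed
  define f' where "f' x = frechet_derivative f (at x)" for x
  define \<psi>' where "\<psi>' z = frechet_derivative \<psi> (at z)" for z
  have Df: "(f has_derivative f' x) (at x)" for x
    unfolding f'_def by (rule C_on_1D(1)[OF f UNIV_I])
  have D\<psi>: "(\<psi> has_derivative \<psi>' z) (at z)" if "z \<in> V" for z
    unfolding \<psi>'_def by (rule C_on_1D(1)[OF sm that])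
  define F where "F u = f (\<psi> (P u))" for u
  define F' where "F' u v = f' (\<psi> (P u)) (\<psi>' (P u) (P v))" for u v
  have D\<psi>P: "((\<lambda>u. \<psi> (P u)) has_derivative (\<lambda>v. \<psi>' (P u) (P v))) (at u)" if "u \<in> D" for u
    using has_derivative_compose[OF bounded_linear_imp_has_derivative[OF blP] D\<psi>[OF DA(4)[OF that]]] .
  have DF: "(F has_derivative F' u) (at u)" if "u \<in> D" for u
    unfolding F_def[abs_def] F'_def[abs_def]
    using has_derivative_compose[OF D\<psi>P[OF that] Df] .
  have contP: "continuous_on S P" for S
    by (rule linear_continuous_on[OF blP])
  have PDV: "P ` D \<subseteq> V" using DA(4) by auto
  have contF': "continuous_on D (\<lambda>u. F' u v)" for v
    unfolding F'_def
  proof (rule continuous_on_linear_apply[where D = "\<lambda>u. f' (\<psi> (P u))" and h = "\<lambda>u. \<psi>' (P u) (P v)"])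
    show "linear (f' (\<psi> (P u)))" for u
      using Df by (rule has_derivative_linear)
    have "continuous_on D (\<lambda>u. \<psi> (P u))"
      using continuous_on_compose2[OF C_on_1D(3)[OF sm] contP PDV] .
    from continuous_on_compose2[OF C_on_1D(2)[OF f] this]
    show "continuous_on D (\<lambda>u. f' (\<psi> (P u)) v)" for v
      by (simp add: f'_def)
    show "continuous_on D (\<lambda>u. \<psi>' (P u) (P v))"
      unfolding \<psi>'_def
      using continuous_on_compose2[OF C_on_1D(2)[OF sm] contP PDV] .
  qed
  \<comment> \<open>The derivative of \<psi> sends \<open>L\<close>, the range of \<open>P\<close>,
    onto the tangent space, so the rank of \<open>F\<close> at \<open>u\<close> is the restricted
    rank of \<open>f\<close> at \<open>\<psi> (P u)\<close>.\<close>
  have rangeF': "range (F' u) = f' (\<psi> (P u)) ` tangent_space A (\<psi> (P u))" if "u \<in> D" for u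
  proof -
    have "tangent_space A (\<psi> (P u)) = \<psi>' (P u) ` range P"
      using tangent_space_chart[OF U(1,3) diff L DA(1,2)[OF that]] DA(5)[OF that]
      by (simp add: \<psi>'_def rangeP)
    then show ?thesis by (auto simp: F'_def)
  qed
  have rankF: "dim (range (F' u)) = restricted_rank f A (\<psi> (P u))" if "u \<in> D" for u
    using rangeF'[OF that] by (simp add: restricted_rank_def f'_def)
  have Pu0: "P u\<^sub>0 = u\<^sub>0" using u0 P(3) by simp
  have rank': "dim (range (F' u)) \<le> dim (range (F' u\<^sub>0))" if "u \<in> D" for u
    using rank[OF DA(3)[OF that]] rankF[OF that] rankF[OF u0D] u0 Pu0 by simp
  have "v \<in> tangent_space A x\<^sub>0" "f' x\<^sub>0 v = 0"
    using v by (auto simp: restricted_kernel_def f'_def)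
  \<comment> \<open>\<open>w\<close> represents \<open>v\<close> in the chart. It lies in
    \<open>L\<close>, so \<open>P\<close> fixes it, and the differential of \<open>F\<close>
    annihilates it.\<close>
  then obtain w where w: "w \<in> L" "v = \<psi>' u\<^sub>0 w"
    using tangent_space_chart[OF U(1,3) diff L A(2) U(2)] by (auto simp: \<psi>'_def u\<^sub>0_def)
  have "F' u\<^sub>0 w = 0"
    using w P(3) Pu0 u0 \<open>f' x\<^sub>0 v = 0\<close> by (simp add: F'_def)
  from constant_rank_curve[OF openD u0D DF contF' rank' this]
  obtain c c' \<epsilon> where c: "0 < \<epsilon>" "c 0 = u\<^sub>0" "c' 0 = w"
    "\<And>t. t \<in> {-\<epsilon><..<\<epsilon>} \<Longrightarrow> c t \<in> D \<and> F (c t) = F u\<^sub>0 \<and> (c has_vector_derivative c' t) (at t)"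
    by metis
  have der: "((\<lambda>t. \<psi> (P (c t))) has_vector_derivative \<psi>' (P (c t)) (P (c' t))) (at t)"
    if "t \<in> {-\<epsilon><..<\<epsilon>}" for t
    using vector_derivative_diff_chain_within[of c "c' t" t UNIV, OF _ has_derivative_at_withinI[OF D\<psi>P]]
      c(4)[OF that] by (simp add: o_def)
  show ?thesis
  proof (rule that[of \<epsilon> "\<lambda>t. \<psi> (P (c t))"])
    show "((\<lambda>t. \<psi> (P (c t))) has_vector_derivative v) (at 0)"
      using der[of 0] c(1,2,3) w P(3) Pu0 by simp
    show "\<psi> (P (c t)) \<in> A \<and> f (\<psi> (P (c t))) = f x\<^sub>0 \<and> (\<lambda>t. \<psi> (P (c t))) differentiable at t"
      if "t \<in> {-\<epsilon><..<\<epsilon>}" for t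
      using c(4)[OF that] DA der[OF that] u0 Pu0 by (auto simp: F_def differentiableI_vector)
  qed (use c u0 Pu0 in auto)
qed

section \<open>Curves that repeatedly return to congruent configurations\<close>

text \<open>A nonzero \<open>h'\<close> is the limit of the difference quotients, which then cannot
  vanish at arbitrarily small positive times.\<close>

lemma vector_derivative_eq_0_if_frequently_eq:
  assumes "(h has_vector_derivative h') (at 0)"
    and "\<exists>\<^sub>F t in at_right 0. h t = h 0"
  shows "h' = 0"
proof (rule ccontr)
  assume "h' \<noteq> 0"
  have "((\<lambda>t. (h t - h 0) /\<^sub>R t) \<longlongrightarrow> h') (at 0)"
    using assms(1) by (rule has_vector_derivative_quotient)
  then have "((\<lambda>t. (h t - h 0) /\<^sub>R t) \<longlongrightarrow> h') (at_right 0)"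
    by (rule tendsto_mono[OF at_le, rotated]) simp
  then have "\<forall>\<^sub>F t in at_right 0. (h t - h 0) /\<^sub>R t \<noteq> 0"
    using \<open>h' \<noteq> 0\<close> by (rule tendsto_imp_eventually_ne)
  then have "\<forall>\<^sub>F t in at_right 0. h t \<noteq> h 0"
    by eventually_elim auto
  with assms(2) show False
    by (simp add: frequently_def)
qed

text \<open>By \<open>graph\<close>, \<open>Z\<close> is the graph of a linear map on
  \<open>U\<close>, its projection to the first factor, and this map is skew as a form on
  \<open>U\<close>. It is first extended by zero on the orthogonal complement of \<open>U\<close>
  and then made skew on the whole space by terms with the adjoint.\<close>

lemma skew_extension:
  fixes Z :: "('a::euclidean_space \<times> 'a) set"
  assumes Z: "subspace Z"
    and graph: "\<And>w. (0, w) \<in> Z \<Longrightarrow> w = 0"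
    and skew: "\<And>x w x' w'. (x, w) \<in> Z \<Longrightarrow> (x', w') \<in> Z \<Longrightarrow> w \<bullet> x' + x \<bullet> w' = 0"
  obtains S where "linear S" "\<And>x y. S x \<bullet> y = - (x \<bullet> S y)" "\<And>x w. (x, w) \<in> Z \<Longrightarrow> S x = w"
proof -
  have inj: "inj_on fst Z"
  proof (rule inj_onI)
    fix p q assume pq: "p \<in> Z" "q \<in> Z" "fst p = fst q"
    then have "(0, snd p - snd q) \<in> Z"
      using subspace_diff[OF Z pq(1,2)] by (simp add: minus_prod_def)
    then have "snd p - snd q = 0" using pq(3) by (intro graph) simp
    then show "p = q" using pq(3) by (simp add: prod_eq_iff)
  qed
  obtain g where g: "range g \<subseteq> Z" "linear g" "\<And>p. p \<in> Z \<Longrightarrow> g (fst p) = p"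
    using linear_exists_left_inverse_on[OF linear_fst Z inj] by auto
  define U where "U = fst ` Z"
  have U: "subspace U"
    unfolding U_def using Z linear_fst by (rule linear_subspace_image[rotated])
  obtain B where B: "B \<subseteq> U" "pairwise orthogonal B" "\<And>b. b \<in> B \<Longrightarrow> norm b = 1" "independent B" "span B = U"
    using orthonormal_basis_subspace[OF U] by metis
  have finB: "finite B" using B(4) by (rule independent_imp_finite)
  define P where "P x = (\<Sum>b\<in>B. (b \<bullet> x) *\<^sub>R b)" for x
  have linP: "linear P"
    unfolding P_def[abs_def]
    by (intro linearI) (simp_all add: inner_add_right scaleR_add_left sum.distrib scaleR_sum_right)
  have PU: "P x \<in> U" for x
    unfolding P_def by (intro subspace_sum subspace_scale U) (use B(1) in auto)
  have Pb: "P b = b" if "b \<in> B" for b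
  proof -
    have "(b' \<bullet> b) *\<^sub>R b' = (if b' = b then b else 0)" if "b' \<in> B" for b'
      using B(2,3) \<open>b \<in> B\<close> that by (auto simp: pairwise_def orthogonal_def norm_eq_1)
    then have "P b = (\<Sum>b'\<in>B. if b' = b then b else 0)"
      unfolding P_def by (intro sum.cong) auto
    then show ?thesis using that finB by simp
  qed
  have P: "P x = x" if "x \<in> U" for x
  proof -
    have "x \<in> span B" using that B(5) by simp
    then show ?thesis
      using linear_eq_on[OF linP linear_id, of x B] Pb by simp
  qed
  have selfadj: "P x \<bullet> y = x \<bullet> P y" for x y
    by (simp add: P_def inner_sum_left inner_sum_right inner_commute mult.commute)
  define C where "C x = snd (g (P x))" for x
  have linC: "linear C"
    using linear_compose[OF linear_compose[OF linP g(2)] linear_snd] by (simp add: C_def[abs_def] o_def)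
  have CZ: "C x = w" if "(x, w) \<in> Z" for x w
  proof -
    have "x \<in> U" using that by (force simp: U_def)
    then show ?thesis using g(3)[OF that] by (simp add: C_def P)
  qed
  have graphC: "(P x, C x) \<in> Z" for x
  proof -
    obtain w where w: "(P x, w) \<in> Z" using PU[of x] by (auto simp: U_def)
    have "C x = w" using g(3)[OF w] by (simp add: C_def)
    then show ?thesis using w by simp
  qed
  have skewC: "C x \<bullet> P y = - (P x \<bullet> C y)" for x y
    using skew[OF graphC graphC, of x y] by linarith
  note adj = adjoint_works[OF linC]
  \<comment> \<open>\<open>C - C\<^sup>T\<close> would double \<open>C\<close> on \<open>U\<close>; the last term corrects this.\<close>
  define S where "S x = C x - adjoint C x + adjoint C (P x)" for x
  have adjS: "adjoint C x \<bullet> y = x \<bullet> C y" for x y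
    using adj[of y x] by (simp add: inner_commute)
  show ?thesis
  proof (rule that[of S])
    show "linear S"
      unfolding S_def[abs_def]
      by (intro linear_compose_add linear_compose_sub linC adjoint_linear
          linear_compose[OF linP adjoint_linear[OF linC], unfolded o_def])
    \<comment> \<open>The adjoint of \<open>C\<close> composed with \<open>P\<close> is skew by
      itself, because \<open>C\<close> is skew when tested against \<open>U\<close>. The difference
      of \<open>C\<close> and its adjoint is always skew, so \<open>S\<close> is a sum of two skew
      maps.\<close>
    have skewC': "adjoint C (P x) \<bullet> y = - (x \<bullet> adjoint C (P y))" for x y
      by (simp add: adj adjS skewC[of x y, symmetric]) (use skewC[of x y] in linarith)
    show "S x \<bullet> y = - (x \<bullet> S y)" for x y
      using skewC'[of x y] by (simp add: S_def inner_add_left inner_add_right inner_diff_left inner_diff_right adj adjS)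
    show "S x = w" if "(x, w) \<in> Z" for x w
    proof -
      have "x \<in> U" using that by (force simp: U_def)
      then show ?thesis using CZ[OF that] by (simp add: S_def P)
    qed
  qed
qed

text \<open>At the return times the Gram matrix has its initial value, so every linear relation
  among the initial vectors holds again and passes to the velocities. Thus the velocities depend
  linearly on the initial vectors. Differentiating the Gram entries shows that this dependence is
  skew, and \<open>skew_extension\<close> extends it.\<close>

lemma skew_velocity_if_frequently_isometric:
  fixes z :: "real \<Rightarrow> 'i::finite \<Rightarrow> 'a::euclidean_space"
  assumes z: "\<And>s. ((\<lambda>t. z t s) has_vector_derivative z' s) (at 0)"
    and freq: "\<exists>\<^sub>F t in at_right 0. \<forall>s s'. z t s \<bullet> z t s' = z 0 s \<bullet> z 0 s'"
  obtains S where "linear S" "\<And>x y. S x \<bullet> y = - (x \<bullet> S y)" "\<And>s. S (z 0 s) = z' s"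
proof -
  define Z where "Z = span (range (\<lambda>s. (z 0 s, z' s)))"
  \<comment> \<open>One family of coefficients serves both components; this transfers relations
    among the initial vectors to the velocities.\<close>
  have repr: "\<exists>c. x = (\<Sum>s\<in>UNIV. c s *\<^sub>R z 0 s) \<and> w = (\<Sum>s\<in>UNIV. c s *\<^sub>R z' s)" if "(x, w) \<in> Z" for x w
  proof -
    let ?R = "{p. \<exists>c. fst p = (\<Sum>s\<in>UNIV. c s *\<^sub>R z 0 s) \<and> snd p = (\<Sum>s\<in>UNIV. c s *\<^sub>R z' s)}"
    have "subspace ?R"
    proof (rule subspaceI; clarsimp)
      show "\<exists>c. (\<Sum>s\<in>UNIV. c s *\<^sub>R z 0 s) = 0 \<and> (\<Sum>s\<in>UNIV. c s *\<^sub>R z' s) = 0"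
        by (rule exI[of _ "\<lambda>_. 0"]) simp
      show "\<exists>c. (\<Sum>s\<in>UNIV. a s *\<^sub>R z 0 s) + (\<Sum>s\<in>UNIV. b s *\<^sub>R z 0 s) = (\<Sum>s\<in>UNIV. c s *\<^sub>R z 0 s) \<and>
          (\<Sum>s\<in>UNIV. a s *\<^sub>R z' s) + (\<Sum>s\<in>UNIV. b s *\<^sub>R z' s) = (\<Sum>s\<in>UNIV. c s *\<^sub>R z' s)" for a b
        by (rule exI[of _ "\<lambda>s. a s + b s"]) (simp add: scaleR_add_left sum.distrib)
      show "\<exists>c. r *\<^sub>R (\<Sum>s\<in>UNIV. a s *\<^sub>R z 0 s) = (\<Sum>s\<in>UNIV. c s *\<^sub>R z 0 s) \<and>
          r *\<^sub>R (\<Sum>s\<in>UNIV. a s *\<^sub>R z' s) = (\<Sum>s\<in>UNIV. c s *\<^sub>R z' s)" for r a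
        by (rule exI[of _ "\<lambda>s. r * a s"]) (simp add: scaleR_sum_right)
    qed
    moreover have "range (\<lambda>s. (z 0 s, z' s)) \<subseteq> ?R"
    proof clarsimp
      fix s
      show "\<exists>c. z 0 s = (\<Sum>s\<in>UNIV. c s *\<^sub>R z 0 s) \<and> z' s = (\<Sum>s\<in>UNIV. c s *\<^sub>R z' s)"
        by (rule exI[of _ "\<lambda>s'. if s' = s then 1 else 0"])
          (simp add: if_distrib[of "\<lambda>c. c *\<^sub>R _"] cong: if_cong)
    qed
    ultimately have "Z \<subseteq> ?R"
      unfolding Z_def by (rule span_minimal[rotated])
    from subsetD[OF this that] show ?thesis by simp
  qed
  have skew0: "z' s \<bullet> z 0 s' + z 0 s \<bullet> z' s' = 0" for s s'
  proof -
    have "((\<lambda>t. z t s \<bullet> z t s') has_vector_derivative z 0 s \<bullet> z' s' + z' s \<bullet> z 0 s') (at 0)"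
      using has_derivative_inner[OF z[of s, unfolded has_vector_derivative_def]
          z[of s', unfolded has_vector_derivative_def]]
      by (simp add: has_vector_derivative_def algebra_simps)
    moreover have "\<exists>\<^sub>F t in at_right 0. z t s \<bullet> z t s' = z 0 s \<bullet> z 0 s'"
      using freq by (rule frequently_elim1) auto
    ultimately have "z 0 s \<bullet> z' s' + z' s \<bullet> z 0 s' = 0"
      by (rule vector_derivative_eq_0_if_frequently_eq)
    then show ?thesis by simp
  qed
  have graph: "w = 0" if w: "(0, w) \<in> Z" for w
  proof -
    obtain c where c: "0 = (\<Sum>s\<in>UNIV. c s *\<^sub>R z 0 s)" "w = (\<Sum>s\<in>UNIV. c s *\<^sub>R z' s)"
      using repr[OF w] by auto
    define h where "h t = (\<Sum>s\<in>UNIV. c s *\<^sub>R z t s)" for t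
    have "(h has_vector_derivative w) (at 0)"
      unfolding h_def[abs_def] c(2)
      by (intro has_vector_derivative_sum bounded_linear.has_vector_derivative[OF bounded_linear_scaleR_right] z)
    moreover have "\<exists>\<^sub>F t in at_right 0. h t = h 0"
      using freq
    proof (rule frequently_elim1)
      fix t assume *: "\<forall>s s'. z t s \<bullet> z t s' = z 0 s \<bullet> z 0 s'"
      \<comment> \<open>The Gram matrix determines the length of \<open>h t\<close>, and
        \<open>h 0\<close> is zero, so \<open>h\<close> vanishes at every return time.\<close>
      have "h t \<bullet> h t = h 0 \<bullet> h 0"
        by (simp add: h_def inner_sum_left inner_sum_right *)
      then show "h t = h 0" using c(1) by (simp add: h_def)
    qed
    ultimately show ?thesis
      by (rule vector_derivative_eq_0_if_frequently_eq)
  qed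
  have skew: "w \<bullet> x' + x \<bullet> w' = 0" if xw: "(x, w) \<in> Z" and xw': "(x', w') \<in> Z" for x w x' w'
  proof -
    obtain c c' where c: "x = (\<Sum>s\<in>UNIV. c s *\<^sub>R z 0 s)" "w = (\<Sum>s\<in>UNIV. c s *\<^sub>R z' s)"
      and c': "x' = (\<Sum>s\<in>UNIV. c' s *\<^sub>R z 0 s)" "w' = (\<Sum>s\<in>UNIV. c' s *\<^sub>R z' s)"
      using repr[OF xw] repr[OF xw'] by blast
    have 0: "z' s \<bullet> x' + z 0 s \<bullet> w' = 0" for s
    proof -
      have "z' s \<bullet> x' + z 0 s \<bullet> w' = (\<Sum>s'\<in>UNIV. c' s' * (z' s \<bullet> z 0 s' + z 0 s \<bullet> z' s'))"
        by (simp add: c' inner_sum_right distrib_left sum.distrib)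
      then show ?thesis by (simp add: skew0)
    qed
    have "w \<bullet> x' + x \<bullet> w' = (\<Sum>s\<in>UNIV. c s * (z' s \<bullet> x' + z 0 s \<bullet> w'))"
      unfolding c by (simp add: inner_sum_left distrib_left sum.distrib)
    then show ?thesis by (simp add: 0)
  qed
  have "subspace Z" by (simp add: Z_def)
  from skew_extension[OF this graph skew] obtain S where S: "linear S" "\<And>x y. S x \<bullet> y = - (x \<bullet> S y)"
    "\<And>x w. (x, w) \<in> Z \<Longrightarrow> S x = w"
    by metis
  have "S (z 0 s) = z' s" for s
    by (rule S(3)) (auto simp: Z_def intro: span_base)
  with S(1,2) that show ?thesis by blast
qed

section \<open>Configurations\<close>

lemma bounded_linear_pt: "bounded_linear (\<lambda>x. pt x i)"
  unfolding pt_def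
  by (rule bounded_linear_compose[OF bounded_linear_vec_nth bounded_linear_fst])

lemma bounded_linear_nrm: "bounded_linear (\<lambda>x. nrm x j)"
  unfolding nrm_def
  by (rule bounded_linear_compose[OF bounded_linear_fst
        bounded_linear_compose[OF bounded_linear_vec_nth bounded_linear_snd]])

lemma bounded_linear_off: "bounded_linear (\<lambda>x. off x j)"
  unfolding off_def
  by (rule bounded_linear_compose[OF bounded_linear_snd
        bounded_linear_compose[OF bounded_linear_vec_nth bounded_linear_snd]])

lemma C_on_1_pair_measurement: "C_on (Suc 0) S (\<lambda>x. pair_measurement x u w)"
proof -
  note C = C_on_1_bounded_linear[OF bounded_linear_pt] C_on_1_bounded_linear[OF bounded_linear_nrm]
    C_on_1_bounded_linear[OF bounded_linear_off]
  show ?thesis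
    by (cases u; cases w)
      (simp_all only: pair_measurement.simps power2_norm_eq_inner,
        (intro C_on_1_inner C_on_1_diff C)+)
qed

lemma C_on_1_measurement:
  fixes S :: "('p::finite, 'h::finite, 'd::finite) config set"
  assumes "\<And>e. e \<in> E \<Longrightarrow> card e = 2"
  shows "C_on (Suc 0) S (measurement E P)"
proof (rule C_on_1_vec)
  fix c
  show "C_on (Suc 0) S (\<lambda>x. measurement E P x $ c)"
  proof (cases c)
    case (Inl e)
    show ?thesis
    proof (cases "e \<in> E - P")
      case True
      then obtain u w where "e = {u, w}"
        using assms[of e] by (auto simp: card_2_iff)
      then show ?thesis
        using Inl True C_on_1_pair_measurement
        by (simp add: measurement_def edge_measurement_pair del: C_on.simps)
    next
      case False
      then have "(\<lambda>x :: ('p, 'h, 'd) config. measurement E P x $ c) = (\<lambda>_. 0)"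
        using Inl by (auto simp: measurement_def)
      then show ?thesis
        by (simp only: C_on_1_const)
    qed
  next
    case (Inr j)
    then show ?thesis
      using C_on_1_inner[OF C_on_1_bounded_linear[OF bounded_linear_nrm]
          C_on_1_bounded_linear[OF bounded_linear_nrm]]
      by (simp add: measurement_def del: C_on.simps)
  qed
qed

section \<open>Parallel classes and the inner products they leave unmeasured\<close>

lemma parallel_trans:
  assumes "parallel a b" "parallel b c" "b \<noteq> 0"
  shows "parallel a c"
proof (cases "a = 0 \<or> c = 0")
  case True
  then show ?thesis by (auto simp: parallel_def collinear_lemma)
next
  case False
  then obtain s t where st: "b = s *\<^sub>R a" "c = t *\<^sub>R b"
    using assms by (auto simp: parallel_def collinear_lemma)
  then have "c = (t * s) *\<^sub>R a" by simp
  then show ?thesis unfolding parallel_def collinear_lemma by blast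
qed

text \<open>Parallelism is passed along a chain of parallel edges. The zero vector is parallel to
  everything, so it is the nonzero normals that make this transitive.\<close>

lemma same_class_parallel:
  assumes "y \<in> W E x\<^sub>0" "\<And>j. nrm y j \<noteq> 0" "same_class E x\<^sub>0 i j"
  shows "parallel (nrm y i) (nrm y j)"
  using assms(3) unfolding same_class_def
proof (induction rule: rtrancl_induct)
  case base
  then show ?case by (simp add: parallel_def)
next
  case (step j k)
  then have "parallel (nrm y j) (nrm y k)"
    using assms(1) by (simp add: W_def)
  with step.IH show ?case
    using assms(2) by (rule parallel_trans)
qed

text \<open>Inside a parallel class the inner products are not measured: they are determined up to sign by
  the lengths, and the hypothesis \<open>pos\<close> fixes the signs.\<close>

lemma pair_measurement_eq_if_f_K_eq:
  assumes W: "x\<^sub>0 \<in> W E x\<^sub>0" "y \<in> W E x\<^sub>0" and nz: "\<And>j. nrm x\<^sub>0 j \<noteq> 0"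
    and eq: "f_K E x\<^sub>0 y = f_K E x\<^sub>0 x\<^sub>0"
    and pos: "\<And>i j. nrm x\<^sub>0 i \<bullet> nrm x\<^sub>0 j \<noteq> 0 \<Longrightarrow> (nrm y i \<bullet> nrm y j) * (nrm x\<^sub>0 i \<bullet> nrm x\<^sub>0 j) > 0"
  shows "pair_measurement y u w = pair_measurement x\<^sub>0 u w"
proof -
  have comp: "f_K E x\<^sub>0 y $ c = f_K E x\<^sub>0 x\<^sub>0 $ c" for c
    using eq by simp
  have inner_self: "nrm y j \<bullet> nrm y j = nrm x\<^sub>0 j \<bullet> nrm x\<^sub>0 j" for j
    using comp[of "Inr j"] by (simp add: f_K_def measurement_def)
  then have norm_eq: "norm (nrm y j) = norm (nrm x\<^sub>0 j)" for j
    by (simp add: norm_eq_sqrt_inner)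
  then have nzy: "nrm y j \<noteq> 0" for j
    using nz[of j] by (metis norm_eq_zero)
  have par: "nrm y i \<bullet> nrm y j = nrm x\<^sub>0 i \<bullet> nrm x\<^sub>0 j" if "same_class E x\<^sub>0 i j" for i j
  proof -
    \<comment> \<open>Equality in the Cauchy-Schwarz inequality: for parallel normals the preserved
      lengths fix the absolute value of the inner product. It is nonzero, so \<open>pos\<close>
      settles the sign.\<close>
    have x: "\<bar>nrm x\<^sub>0 i \<bullet> nrm x\<^sub>0 j\<bar> = norm (nrm x\<^sub>0 i) * norm (nrm x\<^sub>0 j)"
      using same_class_parallel[OF W(1) nz that] by (simp add: parallel_def norm_cauchy_schwarz_equal)
    moreover have "\<bar>nrm y i \<bullet> nrm y j\<bar> = norm (nrm y i) * norm (nrm y j)"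
      using same_class_parallel[OF W(2) nzy that] by (simp add: parallel_def norm_cauchy_schwarz_equal)
    ultimately have abs: "\<bar>nrm y i \<bullet> nrm y j\<bar> = \<bar>nrm x\<^sub>0 i \<bullet> nrm x\<^sub>0 j\<bar>"
      by (simp add: norm_eq)
    have "nrm x\<^sub>0 i \<bullet> nrm x\<^sub>0 j \<noteq> 0"
      using x nz by auto
    from pos[OF this] abs show ?thesis
      by (auto simp: zero_less_mult_iff)
  qed
  have edge: "pair_measurement y u w = pair_measurement x\<^sub>0 u w"
    if "u \<noteq> w" "{u, w} \<notin> complete_parallel_edges E x\<^sub>0"
    using comp[of "Inl {u, w}"] that
    by (simp add: f_K_def measurement_def complete_edges_def edge_measurement_pair)
  show ?thesis
  proof (cases "u = w")
    \<comment> \<open>A loop is not an edge: its value is 0 at a point, and at a hyperplane it is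
      the squared length of the normal.\<close>
    case True
    then show ?thesis using inner_self by (cases u) auto
  next
    case False
    show ?thesis
    proof (cases "{u, w} \<in> complete_parallel_edges E x\<^sub>0")
      case True
      then obtain i j where "{u, w} = {Inr i, Inr j}" "same_class E x\<^sub>0 i j"
        by (auto simp: complete_parallel_edges_def)
      then show ?thesis
        using par[of i j] by (auto simp: doubleton_eq_iff inner_commute)
    qed (use edge False in blast)
  qed
qed

text \<open>The differences of the points to an arbitrary base point \<open>k\<close>, together with
  the normals, form a family whose Gram matrix is determined by the pair measurements. This family
  yields the skew map, and the velocity of the base point then yields the translation.\<close>

lemma trivial_motion_if_frequently_congruent:
  fixes \<gamma> :: "real \<Rightarrow> ('p::finite, 'h::finite, 'd::finite) config"
  assumes \<gamma>: "(\<gamma> has_vector_derivative v) (at 0)"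
    and freq: "\<exists>\<^sub>F t in at_right 0. \<forall>u w. pair_measurement (\<gamma> t) u w = pair_measurement (\<gamma> 0) u w"
  shows "trivial_motion (\<gamma> 0) v"
proof -
  note D = bounded_linear.has_vector_derivative[OF bounded_linear_pt \<gamma>]
    bounded_linear.has_vector_derivative[OF bounded_linear_nrm \<gamma>]
    bounded_linear.has_vector_derivative[OF bounded_linear_off \<gamma>]
  define k :: 'p where "k = undefined"
  define zz :: "('p, 'h, 'd) config \<Rightarrow> 'p + 'h \<Rightarrow> real^'d"
    where "zz x s = (case s of Inl i \<Rightarrow> pt x i - pt x k | Inr j \<Rightarrow> nrm x j)" for x s
  have zz: "zz x (Inl i) = pt x i - pt x k" "zz x (Inr j) = nrm x j" for x i j
    by (simp_all add: zz_def)
  have der: "((\<lambda>t. zz (\<gamma> t) s) has_vector_derivative zz v s) (at 0)" for s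
    by (cases s) (auto simp: zz intro!: derivative_intros D)
  have gram: "zz x s \<bullet> zz x s' = zz y s \<bullet> zz y s'"
    if *: "\<forall>u w. pair_measurement x u w = pair_measurement y u w" for x y s s'
  proof -
    have pp: "(norm (pt x i - pt x j))\<^sup>2 = (norm (pt y i - pt y j))\<^sup>2" for i j
      using *[rule_format, of "Inl i" "Inl j"] by simp
    \<comment> \<open>The offset cancels between two measurements against the same
      hyperplane.\<close>
    have ph: "(pt x i - pt x k) \<bullet> nrm x j = (pt y i - pt y k) \<bullet> nrm y j" for i j
      using *[rule_format, of "Inl i" "Inr j"] *[rule_format, of "Inl k" "Inr j"]
      by (simp add: inner_diff_left)
    have hh: "nrm x i \<bullet> nrm x j = nrm y i \<bullet> nrm y j" for i j
      using *[rule_format, of "Inr i" "Inr j"] by simp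
    \<comment> \<open>Polarization recovers the inner products of the differences from the
      distances.\<close>
    have polar: "2 * ((a - c) \<bullet> (b - c)) = (norm (a - c))\<^sup>2 + (norm (b - c))\<^sup>2 - (norm (a - b))\<^sup>2"
      for a b c :: "real^'d"
      by (simp add: power2_norm_eq_inner inner_diff_left inner_diff_right inner_commute)
    have "(pt x i - pt x k) \<bullet> (pt x j - pt x k) = (pt y i - pt y k) \<bullet> (pt y j - pt y k)" for i j
      using polar[of "pt x i" "pt x k" "pt x j"] polar[of "pt y i" "pt y k" "pt y j"]
      by (simp add: pp)
    then show ?thesis
      using ph hh by (cases s; cases s') (simp_all add: zz inner_commute)
  qed
  have "\<exists>\<^sub>F t in at_right 0. \<forall>s s'. zz (\<gamma> t) s \<bullet> zz (\<gamma> t) s' = zz (\<gamma> 0) s \<bullet> zz (\<gamma> 0) s'"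
    using freq by (rule frequently_elim1) (use gram in blast)
  from skew_velocity_if_frequently_isometric[of "\<lambda>t. zz (\<gamma> t)", OF der this]
  obtain S where S: "linear S" "\<And>x y. S x \<bullet> y = - (x \<bullet> S y)" "\<And>s. S (zz (\<gamma> 0) s) = zz v s"
    by metis
  define b where "b = pt v k - S (pt (\<gamma> 0) k)"
  have "transpose (matrix S) $ i $ j = (- matrix S) $ i $ j" for i j
    using S(2)[of "axis i 1" "axis j 1"]
    by (simp add: transpose_def matrix_def inner_axis inner_axis')
  then have skew: "transpose (matrix S) = - matrix S"
    by (simp add: vec_eq_iff)
  have Sp: "pt v i = S (pt (\<gamma> 0) i) + b" for i
    using S(3)[of "Inl i"] S(1) by (simp add: zz b_def linear_diff algebra_simps)
  have Sa: "nrm v j = S (nrm (\<gamma> 0) j)" for j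
    using S(3)[of "Inr j"] by (simp add: zz)
  \<comment> \<open>The measurement of \<open>k\<close> against \<open>j\<close> has derivative 0.
    After the velocities are inserted, the two terms with \<open>S\<close> cancel by skewness and
    only the one with \<open>b\<close> remains.\<close>
  have off: "off v j = b \<bullet> nrm (\<gamma> 0) j" for j
  proof -
    have "((\<lambda>t. pt (\<gamma> t) k \<bullet> nrm (\<gamma> t) j - off (\<gamma> t) j) has_vector_derivative
        (pt (\<gamma> 0) k \<bullet> nrm v j + pt v k \<bullet> nrm (\<gamma> 0) j) - off v j) (at 0)"
      by (intro has_vector_derivative_diff D bounded_bilinear.has_vector_derivative[OF bounded_bilinear_inner])
    moreover have "\<exists>\<^sub>F t in at_right 0.
        pt (\<gamma> t) k \<bullet> nrm (\<gamma> t) j - off (\<gamma> t) j = pt (\<gamma> 0) k \<bullet> nrm (\<gamma> 0) j - off (\<gamma> 0) j"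
      using freq
      by (rule frequently_elim1) (metis pair_measurement.simps(2))
    ultimately have "(pt (\<gamma> 0) k \<bullet> nrm v j + pt v k \<bullet> nrm (\<gamma> 0) j) - off v j = 0"
      by (rule vector_derivative_eq_0_if_frequently_eq)
    then show ?thesis
      using S(2)[of "pt (\<gamma> 0) k" "nrm (\<gamma> 0) j"] Sa[of j] Sp[of k] by (simp add: inner_add_left)
  qed
  show ?thesis
    unfolding trivial_motion_def using skew Sp Sa off matrix_vector_mul(2)[OF S(1), THEN fun_cong]
    by (intro exI[of _ "matrix S"] exI[of _ b]) simp
qed

section \<open>From a curve in the fibre to a finite flex\<close>

theorem theorem5p7:
  fixes E :: "('p::finite + 'h::finite) set set"
    and x\<^sub>0 :: "('p, 'h, 'd::finite) config"
    and A :: "('p, 'h, 'd) config set"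
  assumes "framework E x\<^sub>0"
    and "smooth_submanifold A" and "A \<subseteq> W E x\<^sub>0" and "x\<^sub>0 \<in> A"
    and "affinely_spanning x\<^sub>0"
    and "regular_point E x\<^sub>0 A"
    and "\<exists>v. infinitesimal_flex E x\<^sub>0 A v"
  shows "\<exists>\<gamma>. finite_flex E x\<^sub>0 A \<gamma>"
proof -
  obtain v where v: "v \<in> restricted_kernel (f_G E x\<^sub>0) A x\<^sub>0" "\<not> trivial_motion x\<^sub>0 v"
    using assms(7) by (auto simp: infinitesimal_flex_def infinitesimal_motion_def)
  have nz: "nrm x\<^sub>0 j \<noteq> 0" for j
    using assms(1) by (simp add: framework_def)
  have C1: "C_on (Suc 0) UNIV (f_G E x\<^sub>0)"
    unfolding f_G_def
    by (rule C_on_1_measurement) (use assms(1) in \<open>auto simp: framework_def ph_graph_def\<close>)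
  obtain N where N: "openin (top_of_set A) N" "x\<^sub>0 \<in> N"
    and max: "restricted_rank (f_G E x\<^sub>0) A x\<^sub>0 = Max (restricted_rank (f_G E x\<^sub>0) A ` N)"
    using assms(6) by (auto simp: regular_point_def)
  \<comment> \<open>\<open>Max\<close> is an upper bound only for a finite set; the dimension of the
    codomain bounds all ranks.\<close>
  have "restricted_rank (f_G E x\<^sub>0) A y \<le> DIM(real^(('p + 'h) set + 'h))" for y
    unfolding restricted_rank_def by (rule dim_subset_UNIV)
  then have "finite (restricted_rank (f_G E x\<^sub>0) A ` N)"
    by (intro finite_subset[OF _ finite_atMost]) blast
  then have rank: "restricted_rank (f_G E x\<^sub>0) A y \<le> restricted_rank (f_G E x\<^sub>0) A x\<^sub>0" if "y \<in> N" for y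
    using that by (simp add: max)
  obtain \<gamma> \<epsilon> where \<epsilon>: "0 < \<epsilon>" and \<gamma>0: "\<gamma> 0 = x\<^sub>0" and D\<gamma>: "(\<gamma> has_vector_derivative v) (at 0)"
    and \<gamma>: "\<And>t. t \<in> {-\<epsilon><..<\<epsilon>} \<Longrightarrow> \<gamma> t \<in> A \<and> f_G E x\<^sub>0 (\<gamma> t) = f_G E x\<^sub>0 x\<^sub>0 \<and> \<gamma> differentiable (at t)"
    using submanifold_fibre_curve[OF assms(2,4) C1 N rank v(1)] by metis
  have "\<forall>\<^sub>F t in at_right 0. f_K E x\<^sub>0 (\<gamma> t) \<noteq> f_K E x\<^sub>0 x\<^sub>0"
  proof (rule ccontr)
    assume "\<not> ?thesis"
    then have freq: "\<exists>\<^sub>F t in at_right 0. f_K E x\<^sub>0 (\<gamma> t) = f_K E x\<^sub>0 x\<^sub>0"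
      by (simp add: frequently_def)
    have inA: "\<forall>\<^sub>F t in at_right 0. \<gamma> t \<in> A"
      using \<epsilon> \<gamma> unfolding eventually_at_right_field by (intro exI[of _ \<epsilon>]) auto
    have lim: "(\<gamma> \<longlongrightarrow> x\<^sub>0) (at_right 0)"
      using has_vector_derivative_continuous[OF D\<gamma>] \<gamma>0
      by (auto simp: continuous_within intro: tendsto_mono[OF at_le])
    \<comment> \<open>By continuity, nonzero inner products of normals keep their sign for small
      times, and finitely many pairs share one time bound. This is the sign condition that
      \<open>pair_measurement_eq_if_f_K_eq\<close> asks for.\<close>
    have pos: "\<forall>\<^sub>F t in at_right 0. \<forall>i j. nrm x\<^sub>0 i \<bullet> nrm x\<^sub>0 j \<noteq> 0 \<longrightarrow>
        (nrm (\<gamma> t) i \<bullet> nrm (\<gamma> t) j) * (nrm x\<^sub>0 i \<bullet> nrm x\<^sub>0 j) > 0"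
    proof (intro eventually_all_finite)
      fix i j
      show "\<forall>\<^sub>F t in at_right 0. nrm x\<^sub>0 i \<bullet> nrm x\<^sub>0 j \<noteq> 0 \<longrightarrow>
          (nrm (\<gamma> t) i \<bullet> nrm (\<gamma> t) j) * (nrm x\<^sub>0 i \<bullet> nrm x\<^sub>0 j) > 0"
      proof (cases "nrm x\<^sub>0 i \<bullet> nrm x\<^sub>0 j = 0")
        case False
        have "((\<lambda>t. (nrm (\<gamma> t) i \<bullet> nrm (\<gamma> t) j) * (nrm x\<^sub>0 i \<bullet> nrm x\<^sub>0 j)) \<longlongrightarrow>
            (nrm x\<^sub>0 i \<bullet> nrm x\<^sub>0 j) * (nrm x\<^sub>0 i \<bullet> nrm x\<^sub>0 j)) (at_right 0)"
          by (intro tendsto_intros bounded_linear.tendsto[OF bounded_linear_nrm] lim)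
        moreover have "(nrm x\<^sub>0 i \<bullet> nrm x\<^sub>0 j) * (nrm x\<^sub>0 i \<bullet> nrm x\<^sub>0 j) > 0"
          using False not_real_square_gt_zero by blast
        ultimately have "\<forall>\<^sub>F t in at_right 0. (nrm (\<gamma> t) i \<bullet> nrm (\<gamma> t) j) * (nrm x\<^sub>0 i \<bullet> nrm x\<^sub>0 j) > 0"
          by (rule order_tendstoD)
        then show ?thesis by eventually_elim simp
      qed simp
    qed
    have "\<exists>\<^sub>F t in at_right 0. \<forall>u w. pair_measurement (\<gamma> t) u w = pair_measurement (\<gamma> 0) u w"
      using frequently_eventually_frequently[OF freq eventually_conj[OF inA pos]]
    proof (rule frequently_elim1)
      fix t
      assume "f_K E x\<^sub>0 (\<gamma> t) = f_K E x\<^sub>0 x\<^sub>0 \<and> \<gamma> t \<in> A \<and>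
        (\<forall>i j. nrm x\<^sub>0 i \<bullet> nrm x\<^sub>0 j \<noteq> 0 \<longrightarrow> (nrm (\<gamma> t) i \<bullet> nrm (\<gamma> t) j) * (nrm x\<^sub>0 i \<bullet> nrm x\<^sub>0 j) > 0)"
      then show "\<forall>u w. pair_measurement (\<gamma> t) u w = pair_measurement (\<gamma> 0) u w"
        using pair_measurement_eq_if_f_K_eq[of x\<^sub>0 E "\<gamma> t"] assms(3,4) nz \<gamma>0 by blast
    qed
    then have "trivial_motion x\<^sub>0 v"
      using trivial_motion_if_frequently_congruent[OF D\<gamma>] \<gamma>0 by simp
    with v(2) show False ..
  qed
  then obtain \<delta>' where \<delta>': "0 < \<delta>'" "\<And>t. 0 < t \<Longrightarrow> t < \<delta>' \<Longrightarrow> f_K E x\<^sub>0 (\<gamma> t) \<noteq> f_K E x\<^sub>0 x\<^sub>0"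
    by (auto simp: eventually_at_right_field)
  \<comment> \<open>Halving makes both bounds strict, so the closed interval from 0 to
    \<open>\<delta>\<close> can be rescaled to the unit interval, with the conclusions still valid
    at its right end.\<close>
  define \<delta> where "\<delta> = min \<epsilon> \<delta>' / 2"
  have \<delta>: "0 < \<delta>" "\<delta> < \<epsilon>" "\<delta> < \<delta>'"
    using \<epsilon> \<delta>'(1) by (auto simp: \<delta>_def)
  have small: "\<delta> * T \<in> {-\<epsilon><..<\<epsilon>}" "\<delta> * T < \<delta>'" if "T \<in> {0..1}" for T
  proof -
    have "0 \<le> \<delta> * T" "\<delta> * T \<le> \<delta>"
      using that \<delta>(1) by (simp_all add: mult_left_le)
    then show "\<delta> * T \<in> {-\<epsilon><..<\<epsilon>}" "\<delta> * T < \<delta>'"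
      using \<delta> \<epsilon> unfolding greaterThanLessThan_iff by linarith+
  qed
  have "finite_flex E x\<^sub>0 A (\<lambda>T. \<gamma> (\<delta> * T))"
    unfolding finite_flex_def
  proof (intro conjI ballI)
    show "(\<lambda>T. \<gamma> (\<delta> * T)) differentiable_on {0..1}"
      unfolding differentiable_on_def
    proof
      fix T :: real assume "T \<in> {0..1}"
      then have "\<gamma> differentiable (at (\<delta> * T))" using small \<gamma> by blast
      moreover have "(\<lambda>T. \<delta> * T) differentiable (at T)" by simp
      ultimately have "(\<lambda>T. \<gamma> (\<delta> * T)) differentiable (at T)"
        using differentiable_chain_at[of "\<lambda>T. \<delta> * T" T \<gamma>] by (simp add: o_def)
      then show "(\<lambda>T. \<gamma> (\<delta> * T)) differentiable (at T within {0..1})"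
        by (rule differentiable_at_withinI)
    qed
    show "(\<lambda>T. \<gamma> (\<delta> * T)) ` {0..1} \<subseteq> A"
      using small(1) \<gamma> by blast
    show "\<gamma> (\<delta> * 0) = x\<^sub>0"
      by (simp add: \<gamma>0)
    fix T :: real assume T: "T \<in> {0<..1}"
    then have T': "T \<in> {0..1}" by simp
    show "f_G E x\<^sub>0 (\<gamma> (\<delta> * T)) = f_G E x\<^sub>0 x\<^sub>0"
      using small(1)[OF T'] \<gamma> by blast
    show "f_K E x\<^sub>0 (\<gamma> (\<delta> * T)) \<noteq> f_K E x\<^sub>0 x\<^sub>0"
      using \<delta>'(2) small(2)[OF T'] T \<delta>(1) by simp
  qed
  then show ?thesis by blast
qed

end
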